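(* Let $n\ge 3$, $\lambda=(1^{a_1},2^{a_2},\ldots,n^{a_n})\vdash n$, and let $X=\sum_{1\leq i<j\leq n} \mathrm{wt}(i,j) I_{i,j}$ be a weighted inversion statistic. Set $\alpha_n(X)=\sum_{1\leq i<j\leq n} \mathrm{wt}(i,j)$ and $\beta_n(X)=\sum_{1\leq i<j\leq n} (j-i-1)\, \mathrm{wt}(i,j)$. Then \[\mathbb{E}_{\lambda}[X]=\left(\frac{1}{2}+\frac{a_2}{n(n-1)}-\frac{a_1(a_1-1)}{2n(n-1)}\right) \alpha_n(X)+\left(\frac{n-n a_1-a_1+a_1^2-2a_2}{n(n-1)(n-2)}\right) \beta_n(X).\]
   Context: $S_n$ is the symmetric group on $[n]$; $C_\lambda$ is the conjugacy class of permutations of cycle type $\lambda$ and $\mathbb{E}_\lambda$ is expectation under the uniform measure on $C_\lambda$. The notation $\lambda=(1^{a_1},\ldots,n^{a_n})$ means $\lambda$ has exactly $a_r$ parts equal to $r$. For $1\le i<j\le n$, $I_{i,j}(\omega)=1$ if $\omega(i)>\omega(j)$ and $0$ otherwise. A weighted inversion statistic is a function $\sum_{1\le i<j\le n}\mathrm{wt}(i,j)I_{i,j}$ on $S_n$ with real weights $\mathrm{wt}(i,j)$. *)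

theory Defs
  imports "HOL-Probability.Probability" "HOL-Combinatorics.Orbits" "HOL-Library.Multiset"
begin

text \<open>An integer partition of \<open>n\<close> is the multiset of its (positive) parts, so \<open>a\<^sub>r\<close> is the
  multiplicity \<open>count \<lambda> r\<close>.\<close>

definition int_partition :: "nat multiset \<Rightarrow> nat \<Rightarrow> bool" (infix "\<turnstile>" 50) where
  "lam \<turnstile> n \<longleftrightarrow> (\<forall>r \<in># lam. 0 < r) \<and> sum_mset lam = n"

text \<open>The symmetric group on \<open>{1..n}\<close>: functions on \<open>nat\<close> that are the identity elsewhere.\<close>

definition sym_group :: "nat \<Rightarrow> (nat \<Rightarrow> nat) set" where
  "sym_group n = {w. w permutes {1..n}}"

text \<open>The cycles of \<open>w\<close> correspond to its distinct orbits on \<open>{1..n}\<close>; fixed points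
  contribute parts equal to 1.\<close>

definition cycle_type :: "nat \<Rightarrow> (nat \<Rightarrow> nat) \<Rightarrow> nat multiset" where
  "cycle_type n w = image_mset card (mset_set (orbit w ` {1..n}))"

definition conj_class :: "nat \<Rightarrow> nat multiset \<Rightarrow> (nat \<Rightarrow> nat) set" where
  "conj_class n lam = {w \<in> sym_group n. cycle_type n w = lam}"

definition class_expectation :: "nat \<Rightarrow> nat multiset \<Rightarrow> ((nat \<Rightarrow> nat) \<Rightarrow> real) \<Rightarrow> real" where
  "class_expectation n lam X = measure_pmf.expectation (pmf_of_set (conj_class n lam)) X"

definition index_pairs :: "nat \<Rightarrow> (nat \<times> nat) set" where
  "index_pairs n = {(i, j). 1 \<le> i \<and> i < j \<and> j \<le> n}"

definition inv_ind :: "nat \<Rightarrow> nat \<Rightarrow> (nat \<Rightarrow> nat) \<Rightarrow> real" where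
  "inv_ind i j w = (if w i > w j then 1 else 0)"

definition weighted_inv_stat :: "nat \<Rightarrow> (nat \<Rightarrow> nat \<Rightarrow> real) \<Rightarrow> (nat \<Rightarrow> nat) \<Rightarrow> real" where
  "weighted_inv_stat n wt w = (\<Sum>(i, j) \<in> index_pairs n. wt i j * inv_ind i j w)"

definition alpha :: "nat \<Rightarrow> (nat \<Rightarrow> nat \<Rightarrow> real) \<Rightarrow> real" where
  "alpha n wt = (\<Sum>(i, j) \<in> index_pairs n. wt i j)"

definition beta :: "nat \<Rightarrow> (nat \<Rightarrow> nat \<Rightarrow> real) \<Rightarrow> real" where
  "beta n wt = (\<Sum>(i, j) \<in> index_pairs n. (real j - real i - 1) * wt i j)"

end

theory Submission
  imports Defs
begin

text \<open>Write \<open>I\<^sub>i\<^sub>j = (1 + sgn (w i - w j)) / 2\<close>. By conjugation invariance, the part of the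
  expectation of \<open>sgn (w i - w j)\<close> with \<open>w i, w j \<notin> {i, j}\<close> vanishes. The remaining part is
  governed by four probabilities, of \<open>i \<leftrightarrow> j\<close>, of \<open>i\<close> and \<open>j\<close> both fixed, of \<open>i \<mapsto> j \<mapsto> k\<close>,
  and of \<open>i\<close> fixed with \<open>j \<mapsto> k\<close>. These do not depend on the points, so they are found by counting
  tuples in a single permutation, which involves only its numbers of fixed points and of
  2-cycles. The sign sums over \<open>k\<close> of the last two are \<open>\<plusminus> 2 (j - i - 1)\<close>, whence \<open>\<beta>\<close>.\<close>

section \<open>Transitivity of the symmetric group on tuples of distinct points\<close>

text \<open>Induction on the tuple: a permutation \<open>s\<close> matching the tails is corrected
  by the transposition of \<open>s x\<close> and \<open>y\<close>. Both points avoid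
  \<open>zs\<close>, so the entries matched already stay in place.\<close>

lemma ex_permutes_map:
  assumes "distinct xs" "distinct ys" "length xs = length ys" "set xs \<subseteq> A" "set ys \<subseteq> A"
  shows "\<exists>s. s permutes A \<and> map s xs = ys"
  using assms
proof (induction xs arbitrary: ys)
  case Nil
  then show ?case by (auto intro: permutes_id)
next
  case (Cons x xs)
  then obtain y zs where ys: "ys = y # zs" by (cases ys) auto
  with Cons obtain s where s: "s permutes A" "map s xs = zs" by force
  have "s x \<notin> set zs"
    using s(2) Cons.prems(1) permutes_inj[OF s(1)] by (auto simp flip: s(2) dest: injD)
  moreover have "y \<notin> set zs" using Cons.prems(2) ys by auto
  ultimately have "map (Transposition.transpose (s x) y) zs = zs"
    by (intro map_idI transpose_apply_other) auto
  then have "map (Transposition.transpose (s x) y \<circ> s) (x # xs) = ys"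
    using s(2) ys by (simp flip: map_map)
  moreover have "Transposition.transpose (s x) y \<circ> s permutes A"
    using Cons.prems ys s(1) permutes_in_image[OF s(1)]
    by (intro permutes_compose permutes_swap_id) auto
  ultimately show ?case by blast
qed

definition distinct_tuples :: "nat \<Rightarrow> 'a set \<Rightarrow> 'a list set" where
  "distinct_tuples k A = {xs. length xs = k \<and> distinct xs \<and> set xs \<subseteq> A}"

lemma finite_distinct_tuples: "finite A \<Longrightarrow> finite (distinct_tuples k A)"
  unfolding distinct_tuples_def
  by (rule finite_subset[OF _ finite_lists_length_eq[of A k]]) auto

lemma card_distinct_tuples_2:
  assumes "finite A"
  shows "real (card (distinct_tuples 2 A)) = real (card A) * (real (card A) - 1)"
proof -
  have "distinct_tuples 2 A = (\<lambda>(x, y). [x, y]) ` (Sigma A (\<lambda>x. A - {x}))"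
    by (auto simp: distinct_tuples_def numeral_2_eq_2 length_Suc_conv image_iff)
  moreover have "inj_on (\<lambda>(x, y). [x, y]) (Sigma A (\<lambda>x. A - {x}))"
    by (auto simp: inj_on_def)
  ultimately have "card (distinct_tuples 2 A) = (\<Sum>x\<in>A. card A - 1)"
    using assms by (simp add: card_image)
  \<comment> \<open>The case split removes the truncated \<open>card A - 1\<close>, which is
    harmless for empty \<open>A\<close> because of the factor \<open>card A\<close>.\<close>
  then show ?thesis by (cases "card A") (auto simp: algebra_simps)
qed

lemma card_distinct_tuples_3:
  assumes "finite A" "3 \<le> card A"
  shows "real (card (distinct_tuples 3 A))
    = real (card A) * (real (card A) - 1) * (real (card A) - 2)"
proof -
  from assms(2) obtain m where m: "card A = m + 3" by (metis le_Suc_ex add.commute)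
  have "{m + 1..m + 3} = {m + 1, m + 2, m + 3}" by auto
  then have "card (distinct_tuples 3 A) = (m + 1) * (m + 2) * (m + 3)"
    using assms m unfolding distinct_tuples_def
    by (simp add: card_lists_distinct_length_eq numeral_3_eq_3 algebra_simps)
  then show ?thesis using m by (simp only: of_nat_mult of_nat_add) (simp add: ac_simps)
qed

section \<open>Counting in a conjugation-invariant set of permutations\<close>

locale conj_invariant =
  fixes A :: "'a set" and C :: "('a \<Rightarrow> 'a) set"
  assumes finite_A: "finite A"
    and permutes_A: "w \<in> C \<Longrightarrow> w permutes A"
    and conj_closed: "w \<in> C \<Longrightarrow> s permutes A \<Longrightarrow> s \<circ> w \<circ> inv s \<in> C"
begin

lemma finite_C: "finite C"
  by (rule finite_subset[OF _ finite_permutations[OF finite_A]]) (use permutes_A in auto)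

text \<open>Conjugation by \<open>s\<close> is a bijection of \<open>C\<close> onto itself, inverted
  by conjugation by \<open>inv s\<close>, and it carries \<open>P\<close> to
  \<open>Q\<close>.\<close>

lemma card_conj:
  assumes s: "s permutes A" and iff: "\<And>w. w \<in> C \<Longrightarrow> Q (s \<circ> w \<circ> inv s) \<longleftrightarrow> P w"
  shows "card {w \<in> C. P w} = card {w \<in> C. Q w}"
proof (rule bij_betw_same_card)
  have ss: "inv s \<circ> s = id" "s \<circ> inv s = id" "inv (inv s) = s"
    using permutes_inv_o[OF s] permutes_inv_inv[OF s] by auto
  have conj: "inv s \<circ> w \<circ> s \<in> C" if "w \<in> C" for w
    using conj_closed[OF that permutes_inv[OF s]] ss by simp
  have id: "s \<circ> (inv s \<circ> w \<circ> s) \<circ> inv s = w" "inv s \<circ> (s \<circ> w \<circ> inv s) \<circ> s = w" for w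
    using ss by (auto simp: fun_eq_iff)
  show "bij_betw (\<lambda>w. s \<circ> w \<circ> inv s) {w \<in> C. P w} {w \<in> C. Q w}"
  proof (rule bij_betw_byWitness[where f' = "\<lambda>w. inv s \<circ> w \<circ> s"])
    show "(\<lambda>w. s \<circ> w \<circ> inv s) ` {w \<in> C. P w} \<subseteq> {w \<in> C. Q w}"
      using iff conj_closed s by auto
    show "(\<lambda>w. inv s \<circ> w \<circ> s) ` {w \<in> C. Q w} \<subseteq> {w \<in> C. P w}"
      using iff[OF conj] conj id(1) by auto
  qed (use id in auto)
qed

text \<open>The symmetric group of \<open>A\<close> is transitive on tuples of distinct points, so the number of
  members of \<open>C\<close> satisfying an equivariant condition on a tuple does not depend on the tuple.\<close>

lemma card_tuple:
  assumes xs: "xs \<in> distinct_tuples k A"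
    and equivariant: "\<And>w s ys. s permutes A \<Longrightarrow> ys \<in> distinct_tuples k A \<Longrightarrow>
      P (s \<circ> w \<circ> inv s) (map s ys) \<longleftrightarrow> P w ys"
    and count: "\<And>w. w \<in> C \<Longrightarrow> card {ys \<in> distinct_tuples k A. P w ys} = c"
  shows "card {w \<in> C. P w xs} * card (distinct_tuples k A) = card C * c"
proof -
  let ?T = "distinct_tuples k A"
  have fin: "finite ?T" by (rule finite_distinct_tuples[OF finite_A])
  have const: "card {w \<in> C. P w ys} = card {w \<in> C. P w xs}" if ys: "ys \<in> ?T" for ys
  proof -
    from xs ys obtain s where s: "s permutes A" "map s xs = ys"
      using ex_permutes_map[of xs ys A] by (auto simp: distinct_tuples_def)
    show ?thesis
      using card_conj[OF s(1), of "\<lambda>w. P w ys" "\<lambda>w. P w xs"] equivariant[OF s(1) xs] s(2) by simp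
  qed
  \<comment> \<open>Double counting of the pairs \<open>(w, ys)\<close> with \<open>P w ys\<close>:
    the count over \<open>w\<close> is the same for each tuple by \<open>const\<close>, the count
    over \<open>ys\<close> the same for each permutation by \<open>count\<close>.\<close>
  have "card {w \<in> C. P w xs} * card ?T = (\<Sum>ys\<in>?T. card {w \<in> C. P w ys})"
    using const by simp
  also have "\<dots> = (\<Sum>ys\<in>?T. \<Sum>w\<in>C. if P w ys then 1 else 0)"
    by (simp only: card_eq_sum sum.inter_filter[OF finite_C])
  also have "\<dots> = (\<Sum>w\<in>C. \<Sum>ys\<in>?T. if P w ys then 1 else 0)"
    by (rule sum.swap)
  also have "\<dots> = (\<Sum>w\<in>C. card {ys \<in> ?T. P w ys})"
    by (simp only: card_eq_sum sum.inter_filter[OF fin])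
  also have "\<dots> = card C * c"
    using count by simp
  finally show ?thesis .
qed

end

section \<open>The counts for the four configurations of images\<close>

text \<open>All that the four counts retain of the cycle type. Here \<open>t\<close> counts the
  points on 2-cycles, not the cycles, so it will be instantiated to twice the multiplicity of the
  part 2.\<close>

locale conj_invariant_counts = conj_invariant +
  fixes f t :: nat
  assumes fixed_points: "w \<in> C \<Longrightarrow> card {x \<in> A. w x = x} = f"
    and two_periodic: "w \<in> C \<Longrightarrow> card {x \<in> A. w x \<noteq> x \<and> w (w x) = x} = t"
begin

lemma card_swapped:
  assumes "i \<in> A" "j \<in> A" "i \<noteq> j"
  shows "real (card {w \<in> C. w i = j \<and> w j = i}) * (real (card A) * (real (card A) - 1))
    = real (card C) * real t"
proof -
  let ?P = "\<lambda>w xs. w (xs ! 0) = xs ! 1 \<and> w (xs ! 1) = xs ! 0"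
  have "card {w \<in> C. ?P w [i, j]} * card (distinct_tuples 2 A) = card C * t"
  proof (rule card_tuple)
    show "[i, j] \<in> distinct_tuples 2 A" using assms by (simp add: distinct_tuples_def)
    show "?P (s \<circ> w \<circ> inv s) (map s ys) \<longleftrightarrow> ?P w ys"
      if "s permutes A" "ys \<in> distinct_tuples 2 A" for w s ys
      using that permutes_inj[OF that(1)] by (auto simp: distinct_tuples_def permutes_inverses(2)[OF that(1)] inj_eq)
    show "card {ys \<in> distinct_tuples 2 A. ?P w ys} = t" if "w \<in> C" for w
    proof -
      \<comment> \<open>A swapped ordered pair is determined by its first entry, which may be any
        point on a 2-cycle.\<close>
      have "{ys \<in> distinct_tuples 2 A. ?P w ys}
          = (\<lambda>x. [x, w x]) ` {x \<in> A. w x \<noteq> x \<and> w (w x) = x}"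
        by (auto simp: distinct_tuples_def numeral_2_eq_2 length_Suc_conv image_iff
            permutes_in_image[OF permutes_A[OF that]])
      with two_periodic[OF that] show ?thesis by (simp add: card_image inj_on_def)
    qed
  qed
  then have "real (card {w \<in> C. ?P w [i, j]}) * real (card (distinct_tuples 2 A))
      = real (card C) * real t"
    by (simp flip: of_nat_mult)
  then show ?thesis by (simp add: card_distinct_tuples_2 finite_A)
qed

lemma card_both_fixed:
  assumes "i \<in> A" "j \<in> A" "i \<noteq> j"
  shows "real (card {w \<in> C. w i = i \<and> w j = j}) * (real (card A) * (real (card A) - 1))
    = real (card C) * (real f * (real f - 1))"
proof -
  let ?P = "\<lambda>w xs. w (xs ! 0) = xs ! 0 \<and> w (xs ! 1) = xs ! 1"
  have "card {w \<in> C. ?P w [i, j]} * card (distinct_tuples 2 A) = card C * (f * (f - 1))"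
  proof (rule card_tuple)
    show "[i, j] \<in> distinct_tuples 2 A" using assms by (simp add: distinct_tuples_def)
    show "?P (s \<circ> w \<circ> inv s) (map s ys) \<longleftrightarrow> ?P w ys"
      if "s permutes A" "ys \<in> distinct_tuples 2 A" for w s ys
      using that permutes_inj[OF that(1)] by (auto simp: distinct_tuples_def permutes_inverses(2)[OF that(1)] inj_eq)
    show "card {ys \<in> distinct_tuples 2 A. ?P w ys} = f * (f - 1)" if "w \<in> C" for w
    proof -
      have "{ys \<in> distinct_tuples 2 A. ?P w ys} = distinct_tuples 2 {x \<in> A. w x = x}"
        by (auto simp: distinct_tuples_def numeral_2_eq_2 length_Suc_conv)
      then have "real (card {ys \<in> distinct_tuples 2 A. ?P w ys}) = real f * (real f - 1)"
        using card_distinct_tuples_2[of "{x \<in> A. w x = x}"] finite_A fixed_points[OF that] by simp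
      also have "\<dots> = real (f * (f - 1))" by (cases f) (auto simp: algebra_simps)
      finally show ?thesis by (simp only: of_nat_eq_iff)
    qed
  qed
  then have "real (card {w \<in> C. ?P w [i, j]}) * real (card (distinct_tuples 2 A))
      = real (card C) * real (f * (f - 1))"
    by (simp flip: of_nat_mult)
  moreover have "real (f * (f - 1)) = real f * (real f - 1)" by (cases f) (auto simp: algebra_simps)
  ultimately show ?thesis by (simp add: card_distinct_tuples_2 finite_A)
qed

lemma card_path:
  assumes "{i, j, k} \<subseteq> A" "distinct [i, j, k]"
  shows "real (card {w \<in> C. w i = j \<and> w j = k})
      * (real (card A) * (real (card A) - 1) * (real (card A) - 2))
    = real (card C) * (real (card A) - real f - real t)"
proof -
  let ?P = "\<lambda>w xs. w (xs ! 0) = xs ! 1 \<and> w (xs ! 1) = xs ! 2"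
  have fu: "f + t = card ({x \<in> A. w x = x} \<union> {x \<in> A. w x \<noteq> x \<and> w (w x) = x})"
    if w: "w \<in> C" for w
    using finite_A fixed_points[OF w] two_periodic[OF w] by (subst card_Un_disjoint) auto
  \<comment> \<open>Needed to read the truncated \<open>card A - (f + t)\<close> as a real
    difference. A member of \<open>C\<close> provides the bound; for empty \<open>C\<close> both
    sides of the claim are 0.\<close>
  have le: "f + t \<le> card A" if "C \<noteq> {}"
  proof -
    from that obtain w where w: "w \<in> C" by auto
    have "f + t = card ({x \<in> A. w x = x} \<union> {x \<in> A. w x \<noteq> x \<and> w (w x) = x})"
      by (rule fu[OF w])
    also have "\<dots> \<le> card A" by (rule card_mono) (auto simp: finite_A)
    finally show "f + t \<le> card A" .
  qed
  have "card {w \<in> C. ?P w [i, j, k]} * card (distinct_tuples 3 A) = card C * (card A - (f + t))"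
  proof (rule card_tuple)
    show "[i, j, k] \<in> distinct_tuples 3 A" using assms by (simp add: distinct_tuples_def)
    show "?P (s \<circ> w \<circ> inv s) (map s ys) \<longleftrightarrow> ?P w ys"
      if "s permutes A" "ys \<in> distinct_tuples 3 A" for w s ys
      using that permutes_inj[OF that(1)] by (auto simp: distinct_tuples_def permutes_inverses(2)[OF that(1)] inj_eq)
    show "card {ys \<in> distinct_tuples 3 A. ?P w ys} = card A - (f + t)" if w: "w \<in> C" for w
    proof -
      note inA = permutes_in_image[OF permutes_A[OF w]] and inj = permutes_inj[OF permutes_A[OF w]]
      \<comment> \<open>A path is determined by its start, which must be neither fixed nor on a
        2-cycle; \<open>w (w x) \<noteq> w x\<close> then follows by injectivity.\<close>
      have "{ys \<in> distinct_tuples 3 A. ?P w ys}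
          = (\<lambda>x. [x, w x, w (w x)]) ` {x \<in> A. w x \<noteq> x \<and> w (w x) \<noteq> x}"
        by (auto simp: distinct_tuples_def numeral_3_eq_3 length_Suc_conv image_iff inA inj_eq[OF inj])
      then have "card {ys \<in> distinct_tuples 3 A. ?P w ys} = card {x \<in> A. w x \<noteq> x \<and> w (w x) \<noteq> x}"
        by (simp add: card_image inj_on_def)
      also have "{x \<in> A. w x \<noteq> x \<and> w (w x) \<noteq> x}
          = A - ({x \<in> A. w x = x} \<union> {x \<in> A. w x \<noteq> x \<and> w (w x) = x})" by auto
      also have "card \<dots> = card A - (f + t)"
        using fu[OF w] finite_A by (subst card_Diff_subset) auto
      finally show ?thesis .
    qed
  qed
  then have "real (card {w \<in> C. ?P w [i, j, k]}) * real (card (distinct_tuples 3 A))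
      = real (card C) * real (card A - (f + t))"
    by (simp flip: of_nat_mult)
  moreover have "real (card C) * real (card A - (f + t))
      = real (card C) * (real (card A) - real f - real t)"
    using le by (cases "C = {}") (auto simp: of_nat_diff)
  moreover have "3 \<le> card A" using card_mono[OF finite_A assms(1)] assms(2) by simp
  ultimately show ?thesis by (simp add: card_distinct_tuples_3 finite_A)
qed

lemma card_fixed_moved:
  assumes "{i, j, k} \<subseteq> A" "distinct [i, j, k]"
  shows "real (card {w \<in> C. w i = i \<and> w j = k})
      * (real (card A) * (real (card A) - 1) * (real (card A) - 2))
    = real (card C) * (real f * (real (card A) - real f))"
proof -
  let ?P = "\<lambda>w xs. w (xs ! 0) = xs ! 0 \<and> w (xs ! 1) = xs ! 2"
  have le: "f \<le> card A" if "C \<noteq> {}"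
  proof -
    from that obtain w where w: "w \<in> C" by auto
    show ?thesis
      unfolding fixed_points[OF w, symmetric] by (rule card_mono) (auto simp: finite_A)
  qed
  have "card {w \<in> C. ?P w [i, j, k]} * card (distinct_tuples 3 A) = card C * (f * (card A - f))"
  proof (rule card_tuple)
    show "[i, j, k] \<in> distinct_tuples 3 A" using assms by (simp add: distinct_tuples_def)
    show "?P (s \<circ> w \<circ> inv s) (map s ys) \<longleftrightarrow> ?P w ys"
      if "s permutes A" "ys \<in> distinct_tuples 3 A" for w s ys
      using that permutes_inj[OF that(1)] by (auto simp: distinct_tuples_def permutes_inverses(2)[OF that(1)] inj_eq)
    show "card {ys \<in> distinct_tuples 3 A. ?P w ys} = f * (card A - f)" if w: "w \<in> C" for w
    proof -
      note inA = permutes_in_image[OF permutes_A[OF w]] and inj = permutes_inj[OF permutes_A[OF w]]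
      let ?F = "{x \<in> A. w x = x}"
      \<comment> \<open>The fixed point \<open>x\<close> and the moved point \<open>y\<close> are
        chosen independently, which gives the product \<open>f * (card A - f)\<close>.\<close>
      have "{ys \<in> distinct_tuples 3 A. ?P w ys} = (\<lambda>(x, y). [x, y, w y]) ` (?F \<times> (A - ?F))"
      proof (intro equalityI subsetI)
        fix ys assume ys: "ys \<in> {ys \<in> distinct_tuples 3 A. ?P w ys}"
        then obtain x y z where "ys = [x, y, z]"
          by (auto simp: distinct_tuples_def numeral_3_eq_3 length_Suc_conv)
        with ys have "ys = (\<lambda>(x, y). [x, y, w y]) (x, y)" "(x, y) \<in> ?F \<times> (A - ?F)"
          by (auto simp: distinct_tuples_def)
        then show "ys \<in> (\<lambda>(x, y). [x, y, w y]) ` (?F \<times> (A - ?F))" by (rule image_eqI)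
      next
        fix ys assume "ys \<in> (\<lambda>(x, y). [x, y, w y]) ` (?F \<times> (A - ?F))"
        then obtain x y where xy: "ys = [x, y, w y]" "x \<in> A" "w x = x" "y \<in> A" "w y \<noteq> y" by auto
        \<comment> \<open>\<open>w y = x = w x\<close> would force \<open>y = x\<close>.\<close>
        have "x \<noteq> y" "w y \<noteq> x" using xy injD[OF inj, of x y] by auto
        with xy show "ys \<in> {ys \<in> distinct_tuples 3 A. ?P w ys}"
          by (auto simp: distinct_tuples_def inA)
      qed
      then have "card {ys \<in> distinct_tuples 3 A. ?P w ys} = card (?F \<times> (A - ?F))"
        by (simp add: card_image inj_on_def split_beta prod_eq_iff)
      also have "\<dots> = f * (card A - f)"
        using finite_A fixed_points[OF w] by (simp add: card_cartesian_product card_Diff_subset)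
      finally show ?thesis .
    qed
  qed
  then have "real (card {w \<in> C. ?P w [i, j, k]}) * real (card (distinct_tuples 3 A))
      = real (card C) * real (f * (card A - f))"
    by (simp flip: of_nat_mult)
  moreover have "real (card C) * real (f * (card A - f))
      = real (card C) * (real f * (real (card A) - real f))"
    using le by (cases "C = {}") (auto simp: of_nat_diff)
  moreover have "3 \<le> card A" using card_mono[OF finite_A assms(1)] assms(2) by simp
  ultimately show ?thesis by (simp add: card_distinct_tuples_3 finite_A)
qed

end


section \<open>Orbits and cycle type\<close>

lemma permutation_of_permutes: "w permutes A \<Longrightarrow> finite A \<Longrightarrow> permutation w"
  by (auto simp: permutation_permutes)

lemma orbit_eq_of_mem:
  assumes "permutation w" "y \<in> orbit w x"
  shows "orbit w y = orbit w x"
  using orbit_cyclic_eq3[OF cyclic_on_orbit'[OF assms(1)] assms(2)] .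

lemma card_orbit_eq_1_iff:
  assumes "permutation w"
  shows "card (orbit w x) = 1 \<longleftrightarrow> w x = x"
proof
  assume "card (orbit w x) = 1"
  then obtain y where "orbit w x = {y}" by (auto simp: card_1_singleton_iff)
  then show "w x = x"
    using permutation_self_in_orbit[OF assms, of x] orbit.base[of w x] by simp
next
  assume "w x = x"
  then show "card (orbit w x) = 1" by (simp add: orbit_eq_singleton_iff[THEN iffD2])
qed

lemma card_orbit_eq_2_iff:
  assumes "permutation w"
  shows "card (orbit w x) = 2 \<longleftrightarrow> w x \<noteq> x \<and> w (w x) = x"
proof
  assume *: "card (orbit w x) = 2"
  have ne: "w x \<noteq> x" using * card_orbit_eq_1_iff[OF assms, of x] by auto
  have sub: "{x, w x, w (w x)} \<subseteq> orbit w x"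
    using permutation_self_in_orbit[OF assms, of x] by (auto intro: orbit.intros)
  have "w (w x) \<noteq> w x" using ne injD[OF bij_is_inj[OF permutation_bijective[OF assms]]] by metis
  \<comment> \<open>An infinite orbit would have \<open>card\<close> 0, so cardinality 2 also yields
    the finiteness that monotonicity requires.\<close>
  moreover have "card {x, w x, w (w x)} \<le> 2"
    using card_mono[OF _ sub] * card.infinite by fastforce
  ultimately show "w x \<noteq> x \<and> w (w x) = x"
    using ne by (auto simp: card_insert_if split: if_splits)
next
  assume *: "w x \<noteq> x \<and> w (w x) = x"
  have "y \<in> {x, w x}" if "y \<in> orbit w x" for y
    using that by induction (use * in auto)
  then have "orbit w x = {x, w x}"
    using permutation_self_in_orbit[OF assms, of x] by (auto intro: orbit.intros)
  then show "card (orbit w x) = 2" using conjunct1[OF *, symmetric] by simp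
qed

text \<open>The orbits of size \<open>r\<close> partition these points. The cases
  \<open>r = 1\<close> and \<open>r = 2\<close> translate the multiplicities of parts into fixed
  points and points on 2-cycles.\<close>

lemma card_points_in_orbits_of_size:
  assumes w: "w permutes {1..n}"
  shows "card {x \<in> {1..n}. card (orbit w x) = r} = r * count (cycle_type n w) r"
proof -
  have p: "permutation w" using w by (rule permutation_of_permutes) simp
  let ?O = "{b \<in> orbit w ` {1..n}. card b = r}"
  have un: "\<Union>?O = {x \<in> {1..n}. card (orbit w x) = r}"
  proof (intro equalityI subsetI)
    fix x assume "x \<in> \<Union>?O"
    then obtain y where y: "y \<in> {1..n}" "x \<in> orbit w y" "card (orbit w y) = r" by blast
    then show "x \<in> {x \<in> {1..n}. card (orbit w x) = r}"
      using permutes_orbit_subset[OF w y(1)] orbit_eq_of_mem[OF p y(2)] by auto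
  next
    fix x assume "x \<in> {x \<in> {1..n}. card (orbit w x) = r}"
    then show "x \<in> \<Union>?O" using permutation_self_in_orbit[OF p, of x] by blast
  qed
  have "r * card ?O = card (\<Union>?O)"
  proof (rule card_partition)
    show "finite (\<Union>?O)" unfolding un by simp
    show "c1 \<inter> c2 = {}" if "c1 \<in> ?O" "c2 \<in> ?O" "c1 \<noteq> c2" for c1 c2
      using that orbit_eq_of_mem[OF p] by blast
  qed auto
  moreover have "card ?O = count (cycle_type n w) r"
  proof -
    have "count (cycle_type n w) r = (\<Sum>b\<in>?O. count (mset_set (orbit w ` {1..n})) b)"
      unfolding cycle_type_def count_image_mset' by (rule sum.cong) auto
    also have "\<dots> = (\<Sum>b\<in>?O. 1)"
      by (rule sum.cong) auto
    finally show ?thesis by simp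
  qed
  ultimately show ?thesis unfolding un by simp
qed

lemma orbit_conj:
  assumes "permutation w" "bij s"
  shows "orbit (s \<circ> w \<circ> inv s) (s x) = s ` orbit w x"
  by (rule orbit_inverse[symmetric])
    (use assms in \<open>auto simp: permutation_self_in_orbit bij_is_inj inv_f_f\<close>)

text \<open>The orbits of the conjugate are the images under \<open>s\<close> of the orbits of
  \<open>w\<close>; injectivity of \<open>s\<close> keeps them distinct and of the same
  size.\<close>

lemma cycle_type_conj:
  assumes w: "w permutes {1..n}" and s: "s permutes {1..n}"
  shows "cycle_type n (s \<circ> w \<circ> inv s) = cycle_type n w"
proof -
  have p: "permutation w" using w by (rule permutation_of_permutes) simp
  have inj: "inj s" and bij: "bij s" using permutes_inj[OF s] permutes_bij[OF s] by auto
  have "orbit (s \<circ> w \<circ> inv s) ` {1..n} = orbit (s \<circ> w \<circ> inv s) ` (s ` {1..n})"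
    using permutes_image[OF s] by simp
  also have "\<dots> = image s ` (orbit w ` {1..n})"
    unfolding image_image by (intro image_cong refl orbit_conj p bij)
  finally have orb: "orbit (s \<circ> w \<circ> inv s) ` {1..n} = image s ` (orbit w ` {1..n})" .
  have "inj_on (image s) (orbit w ` {1..n})"
    using inj by (auto intro!: inj_onI simp: inj_image_eq_iff)
  then have "mset_set (image s ` (orbit w ` {1..n}))
      = image_mset (image s) (mset_set (orbit w ` {1..n}))"
    by (rule image_mset_mset_set[symmetric])
  moreover have "card (s ` b) = card b" for b
    by (rule card_image[OF inj_on_subset[OF inj subset_UNIV]])
  ultimately show ?thesis
    unfolding cycle_type_def orb by (simp add: multiset.map_comp o_def)
qed

section \<open>Existence of a permutation of given cycle type\<close>

lemma ex_full_cycle: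
  fixes m r :: nat
  assumes "0 < r"
  obtains c where "c permutes {m + 1..m + r}" "cyclic_on c {m + 1..m + r}"
proof -
  \<comment> \<open>\<open>c\<close> shifts the block by one and wraps around at its end;
    \<open>d\<close> is its inverse on the block.\<close>
  define c where "c x = (if m < x \<and> x < m + r then x + 1 else if x = m + r then m + 1 else x)" for x
  define d where "d x = (if x = m + 1 then m + r else x - 1)" for x :: nat
  let ?S = "{m + 1..m + r}"
  have c: "c permutes ?S"
  proof (rule bij_imp_permutes)
    show "bij_betw c ?S ?S"
      by (rule bij_betw_byWitness[where f' = d]) (use assms in \<open>auto simp: c_def d_def\<close>)
    show "c x = x" if "x \<notin> ?S" for x
      using that assms by (auto simp: c_def)
  qed
  have mem: "m + 1 + k \<in> orbit c (m + 1)" if "k < r" for k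
    using that
  proof (induction k)
    case 0
    have "permutation c" using c by (auto simp: permutation_permutes)
    then show ?case by (simp add: permutation_self_in_orbit)
  next
    case (Suc k)
    then have "c (m + 1 + k) = m + 1 + Suc k" by (simp add: c_def)
    then show ?case using Suc orbit.step[of "m + 1 + k" c "m + 1"] by simp
  qed
  have "?S \<subseteq> orbit c (m + 1)"
  proof
    fix x assume "x \<in> ?S"
    then show "x \<in> orbit c (m + 1)" using mem[of "x - (m + 1)"] assms by auto
  qed
  then have "?S = orbit c (m + 1)"
    using permutes_orbit_subset[OF c, of "m + 1"] assms by auto
  then have "cyclic_on c ?S"
    by (rule cyclic_on_singleI[rotated]) (use assms in simp)
  with c show thesis by (rule that)
qed

text \<open>Induction on the parts: a new part \<open>r\<close> is realised by a full cycle on the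
  \<open>r\<close> points following those already used. Disjointness of the supports leaves the old
  orbits unchanged.\<close>

lemma ex_permutation_of_cycle_type:
  assumes "\<forall>r \<in># lam. 0 < r"
  shows "\<exists>w. w permutes {1..sum_mset lam} \<and> cycle_type (sum_mset lam) w = lam"
  using assms
proof (induction lam)
  case empty
  show ?case by (auto simp: cycle_type_def intro: permutes_id)
next
  case (add r mu)
  let ?m = "sum_mset mu"
  let ?M = "{1..?m}" and ?S = "{?m + 1..?m + r}"
  from add obtain w where w: "w permutes ?M" and type: "cycle_type ?m w = mu" by auto
  from add.prems obtain c where c: "c permutes ?S" and cyc: "cyclic_on c ?S"
    using ex_full_cycle[of r ?m] by auto
  have un: "{1..?m + r} = ?M \<union> ?S" by auto
  have perm: "c \<circ> w permutes {1..?m + r}"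
    unfolding un by (intro permutes_compose permutes_subset[OF c] permutes_subset[OF w]) auto
  have disj: "?S \<inter> ?M = {}" by auto
  have S: "orbit (c \<circ> w) x = ?S" if "x \<in> ?S" for x
    using orbit_cyclic_eq3[OF permutes_comp_preserves_cyclic1[OF w cyc disj] that] by blast
  have M: "orbit (c \<circ> w) x = orbit w x" if "x \<in> ?M" for x
  proof (rule orbit_cyclic_eq3)
    show "cyclic_on (c \<circ> w) (orbit w x)"
      using cyclic_on_orbit[OF w] permutes_orbit_subset[OF w that]
      by (intro permutes_comp_preserves_cyclic2[OF c _ disj]) auto
    show "x \<in> orbit w x"
      by (intro permutation_self_in_orbit permutation_of_permutes[OF w]) simp
  qed
  have ne: "?S \<noteq> {}" using add.prems by auto
  then have "orbit (c \<circ> w) ` ?S = {?S}" using S by (metis image_constant_conv image_cong)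
  moreover have "orbit (c \<circ> w) ` ?M = orbit w ` ?M" using M by (intro image_cong) auto
  ultimately have orb: "orbit (c \<circ> w) ` {1..?m + r} = insert ?S (orbit w ` ?M)"
    unfolding un image_Un by auto
  \<comment> \<open>The new block is a new element of the set of orbits, so \<open>insert\<close>
    adds exactly one part, even if \<open>r\<close> already occurs in \<open>mu\<close>.\<close>
  have "?S \<notin> orbit w ` ?M"
    using permutes_orbit_subset[OF w] ne disj by fastforce
  then have "cycle_type (?m + r) (c \<circ> w) = add_mset r mu"
    unfolding cycle_type_def orb using type by (simp add: cycle_type_def)
  with perm show ?case by (auto simp: add.commute)
qed


section \<open>The sum of an antisymmetric function of two images\<close>

text \<open>The contributions of \<open>w i, w j \<notin> {i, j}\<close> cancel, by conjugation with the transposition of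
  \<open>w i\<close> and \<open>w j\<close>.\<close>

lemma (in conj_invariant) card_images_swap:
  assumes "k \<in> A - {i, j}" "l \<in> A - {i, j}"
  shows "card {w \<in> C. w i = k \<and> w j = l} = card {w \<in> C. w i = l \<and> w j = k}"
proof (rule card_conj)
  let ?s = "Transposition.transpose k l"
  show "?s permutes A" using assms by (intro permutes_swap_id) auto
  fix w
  have "?s i = i" "?s j = j" using assms by (auto intro: transpose_apply_other)
  then show "((?s \<circ> w \<circ> inv ?s) i = l \<and> (?s \<circ> w \<circ> inv ?s) j = k) = (w i = k \<and> w j = l)"
    by (auto simp: transpose_eq_iff)
qed

text \<open>The two signs agree for \<open>k\<close> strictly between \<open>i\<close> and
  \<open>j\<close> and cancel for \<open>k\<close> outside the interval; there are
  \<open>j - i - 1\<close> points between.\<close>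

lemma sum_sgn_between:
  fixes i j n :: nat
  assumes "1 \<le> i" "i < j" "j \<le> n"
  shows "(\<Sum>k\<in>{1..n} - {i, j}. sgn (real j - real k) + sgn (real k - real i))
    = 2 * (real j - real i - 1)"
proof -
  have "(\<Sum>k\<in>{1..n} - {i, j}. sgn (real j - real k) + sgn (real k - real i))
      = (\<Sum>k\<in>{1..n} - {i, j}. if k \<in> {i<..<j} then 2 else 0)"
    using assms by (intro sum.cong) (auto simp: sgn_if)
  also have "\<dots> = (\<Sum>k\<in>{i<..<j}. 2)"
    using assms by (intro sum.mono_neutral_cong_right) auto
  also have "\<dots> = 2 * (real j - real i - 1)"
    using assms by (simp add: of_nat_diff)
  finally show ?thesis .
qed

lemma (in conj_invariant) sum_over_images:
  fixes g :: "'a \<Rightarrow> 'a \<Rightarrow> real"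
  assumes "i \<in> A" "j \<in> A"
  shows "(\<Sum>w\<in>C. g (w i) (w j))
    = (\<Sum>k\<in>A. \<Sum>l\<in>A. g k l * real (card {w \<in> C. w i = k \<and> w j = l}))"
proof -
  have "g (w i) (w j) = (\<Sum>k\<in>A. \<Sum>l\<in>A. if w i = k \<and> w j = l then g k l else 0)" if "w \<in> C" for w
  proof -
    have "w i \<in> A" "w j \<in> A" using assms permutes_in_image[OF permutes_A[OF that]] by auto
    moreover have "(\<Sum>l\<in>A. if w i = k \<and> w j = l then g k l else 0)
        = (if w i = k then (if w j \<in> A then g k (w j) else 0) else 0)" for k
      using finite_A by auto
    ultimately show ?thesis using finite_A by simp
  qed
  then have "(\<Sum>w\<in>C. g (w i) (w j))
      = (\<Sum>w\<in>C. \<Sum>k\<in>A. \<Sum>l\<in>A. if w i = k \<and> w j = l then g k l else 0)"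
    by (intro sum.cong) auto
  also have "\<dots> = (\<Sum>k\<in>A. \<Sum>w\<in>C. \<Sum>l\<in>A. if w i = k \<and> w j = l then g k l else 0)"
    by (rule sum.swap)
  also have "\<dots> = (\<Sum>k\<in>A. \<Sum>l\<in>A. \<Sum>w\<in>C. if w i = k \<and> w j = l then g k l else 0)"
    by (intro sum.cong refl sum.swap)
  also have "\<dots> = (\<Sum>k\<in>A. \<Sum>l\<in>A. g k l * real (card {w \<in> C. w i = k \<and> w j = l}))"
    using finite_C by (simp add: mult.commute flip: sum.inter_filter)
  finally show ?thesis .
qed

text \<open>The pairs \<open>(w i, w j)\<close> are split by which entries lie in
  \<open>{i, j}\<close>. What survives is the four configurations, each up to exchanging
  \<open>i\<close> and \<open>j\<close>; the conditions are ordered so that every set has the form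
  of a path or of a fixed point with a moved point.\<close>

lemma (in conj_invariant) sum_antisym:
  fixes g :: "'a \<Rightarrow> 'a \<Rightarrow> real"
  assumes "i \<in> A" "j \<in> A" "i \<noteq> j" and anti: "\<And>k l. g l k = - g k l"
  shows "(\<Sum>w\<in>C. g (w i) (w j))
    = g j i * (real (card {w \<in> C. w i = j \<and> w j = i}) - real (card {w \<in> C. w i = i \<and> w j = j}))
    + (\<Sum>k\<in>A - {i, j}. g j k * real (card {w \<in> C. w i = j \<and> w j = k})
        + g k i * real (card {w \<in> C. w j = i \<and> w i = k})
        + g i k * real (card {w \<in> C. w i = i \<and> w j = k})
        + g k j * real (card {w \<in> C. w j = j \<and> w i = k}))"
proof -
  define c where "c k l = real (card {w \<in> C. w i = k \<and> w j = l})" for k l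
  let ?B = "A - {i, j}"
  have diag: "g k k = 0" for k using anti[of k k] by simp
  have fin: "finite ?B" using finite_A by simp
  have expand: "(\<Sum>k\<in>A. h k) = h i + h j + (\<Sum>k\<in>?B. h k)" for h :: "'a \<Rightarrow> real"
  proof -
    have "A = insert i (insert j ?B)" using assms by auto
    then have "sum h A = sum h (insert i (insert j ?B))" by simp
    also have "\<dots> = h i + h j + sum h ?B" using fin assms(3) by simp
    finally show ?thesis .
  qed
  \<comment> \<open>Exchanging \<open>k\<close> and \<open>l\<close> preserves \<open>c\<close> and
    negates \<open>g\<close>, so this sum equals its own negative.\<close>
  have "(\<Sum>k\<in>?B. \<Sum>l\<in>?B. g k l * c k l) = (\<Sum>k\<in>?B. \<Sum>l\<in>?B. g l k * c l k)"
    by (rule sum.swap)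
  also have "\<dots> = (\<Sum>k\<in>?B. \<Sum>l\<in>?B. - (g k l * c k l))"
  proof (intro sum.cong refl)
    fix k l assume "k \<in> ?B" "l \<in> ?B"
    then have "c l k = c k l" unfolding c_def using card_images_swap by simp
    then show "g l k * c l k = - (g k l * c k l)" by (simp add: anti[of l k])
  qed
  finally have zero: "(\<Sum>k\<in>?B. \<Sum>l\<in>?B. g k l * c k l) = 0"
    by (simp add: sum_negf)
  have "(\<Sum>w\<in>C. g (w i) (w j)) = (\<Sum>k\<in>A. \<Sum>l\<in>A. g k l * c k l)"
    unfolding c_def by (rule sum_over_images[OF assms(1,2)])
  also have "\<dots> = g i j * c i j + g j i * c j i + ((\<Sum>l\<in>?B. g i l * c i l) + (\<Sum>l\<in>?B. g j l * c j l)
      + (\<Sum>k\<in>?B. g k i * c k i) + (\<Sum>k\<in>?B. g k j * c k j))"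
    unfolding expand sum.distrib zero using diag by (simp add: algebra_simps)
  also have "g i j = - g j i" by (rule anti)
  finally show ?thesis
    by (simp add: c_def sum.distrib algebra_simps conj_commute)
qed

section \<open>The number of inversions at a pair of positions\<close>

lemma sum_inv_ind:
  assumes inv: "conj_invariant_counts {1..n} C f t" and n: "3 \<le> n"
    and ij: "1 \<le> i" "i < j" "j \<le> n"
  shows "(\<Sum>w\<in>C. inv_ind i j w) = real (card C) *
    (1 / 2 + real t / (2 * real n * (real n - 1)) - real f * (real f - 1) / (2 * real n * (real n - 1))
     + (real n - real n * real f - real f + (real f)\<^sup>2 - real t)
        / (real n * (real n - 1) * (real n - 2)) * (real j - real i - 1))"
proof -
  interpret conj_invariant_counts "{1..n}" C f t by (rule inv)
  let ?N = "real n * (real n - 1)" and ?M = "real n * (real n - 1) * (real n - 2)"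
  let ?g = "\<lambda>k l. sgn (real k - real l)"
  let ?B = "{1..n} - {i, j}"
  \<comment> \<open>The common number of \<open>w\<close> in \<open>C\<close> following a prescribed
    path of three points (\<open>p3\<close>), or with a prescribed fixed point and a prescribed
    image of a moved point (\<open>p4\<close>).\<close>
  define p3 p4 where "p3 = real (card C) * (real n - real f - real t) / ?M"
    and "p4 = real (card C) * (real f * (real n - real f)) / ?M"
  have N: "?N \<noteq> 0" and M: "?M \<noteq> 0" using n by auto
  have ijA: "i \<in> {1..n}" "j \<in> {1..n}" "i \<noteq> j" using ij by auto
  have swapped: "real (card {w \<in> C. w i = j \<and> w j = i}) = real (card C) * real t / ?N"
    using card_swapped[OF ijA] N by (simp add: eq_divide_eq)
  have fixed: "real (card {w \<in> C. w i = i \<and> w j = j}) = real (card C) * (real f * (real f - 1)) / ?N"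
    using card_both_fixed[OF ijA] N by (simp add: eq_divide_eq)
  have path: "real (card {w \<in> C. w x = y \<and> w y = z}) = p3"
    if "{x, y, z} \<subseteq> {1..n}" "distinct [x, y, z]" for x y z
    using card_path[OF that] M by (simp add: eq_divide_eq p3_def)
  have moved: "real (card {w \<in> C. w x = x \<and> w y = z}) = p4"
    if "{x, y, z} \<subseteq> {1..n}" "distinct [x, y, z]" for x y z
    using card_fixed_moved[OF that] M by (simp add: eq_divide_eq p4_def)
  have "(\<Sum>w\<in>C. ?g (w i) (w j))
      = real (card C) * (real t - real f * (real f - 1)) / ?N
        + (\<Sum>k\<in>?B. ?g j k * p3 + ?g k i * p3 + ?g i k * p4 + ?g k j * p4)"
  proof -
    have "(\<Sum>k\<in>?B. ?g j k * real (card {w \<in> C. w i = j \<and> w j = k})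
        + ?g k i * real (card {w \<in> C. w j = i \<and> w i = k})
        + ?g i k * real (card {w \<in> C. w i = i \<and> w j = k})
        + ?g k j * real (card {w \<in> C. w j = j \<and> w i = k}))
      = (\<Sum>k\<in>?B. ?g j k * p3 + ?g k i * p3 + ?g i k * p4 + ?g k j * p4)"
    proof (rule sum.cong[OF refl])
      fix k assume "k \<in> ?B"
      then have "{i, j, k} \<subseteq> {1..n}" "distinct [i, j, k]" "{j, i, k} \<subseteq> {1..n}" "distinct [j, i, k]"
        using ijA by auto
      then show "?g j k * real (card {w \<in> C. w i = j \<and> w j = k})
          + ?g k i * real (card {w \<in> C. w j = i \<and> w i = k})
          + ?g i k * real (card {w \<in> C. w i = i \<and> w j = k})
          + ?g k j * real (card {w \<in> C. w j = j \<and> w i = k})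
        = ?g j k * p3 + ?g k i * p3 + ?g i k * p4 + ?g k j * p4"
        by (simp only: path moved)
    qed
    moreover have "(\<Sum>w\<in>C. ?g (w i) (w j))
      = ?g j i * (real (card {w \<in> C. w i = j \<and> w j = i}) - real (card {w \<in> C. w i = i \<and> w j = j}))
      + (\<Sum>k\<in>?B. ?g j k * real (card {w \<in> C. w i = j \<and> w j = k})
        + ?g k i * real (card {w \<in> C. w j = i \<and> w i = k})
        + ?g i k * real (card {w \<in> C. w i = i \<and> w j = k})
        + ?g k j * real (card {w \<in> C. w j = j \<and> w i = k}))"
      by (rule sum_antisym[OF ijA]) (simp add: sgn_if)
    moreover have "?g j i = 1" using ij by simp
    ultimately show ?thesis
      by (simp only: swapped fixed mult_1 diff_divide_distrib right_diff_distrib)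
  qed
  \<comment> \<open>The signs multiplying \<open>p4\<close> are the negatives of those multiplying
    \<open>p3\<close>.\<close>
  also have "(\<Sum>k\<in>?B. ?g j k * p3 + ?g k i * p3 + ?g i k * p4 + ?g k j * p4)
      = (p3 - p4) * (\<Sum>k\<in>?B. ?g j k + ?g k i)"
    unfolding sum_distrib_left by (intro sum.cong refl) (auto simp: sgn_if algebra_simps)
  also have "\<dots> = (p3 - p4) * (2 * (real j - real i - 1))"
    by (simp only: sum_sgn_between[OF ij])
  finally have sgn: "(\<Sum>w\<in>C. ?g (w i) (w j)) = real (card C) * (real t - real f * (real f - 1)) / ?N
      + (p3 - p4) * (2 * (real j - real i - 1))" .
  \<comment> \<open>Injectivity of \<open>w\<close> rules out \<open>w i = w j\<close>, so the sign
    is 1 or -1.\<close>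
  have "inv_ind i j w = (1 + ?g (w i) (w j)) / 2" if "w \<in> C" for w
    using injD[OF permutes_inj[OF permutes_A[OF that]], of i j] ij(2)
    by (auto simp: inv_ind_def sgn_if)
  then have "(\<Sum>w\<in>C. inv_ind i j w) = (\<Sum>w\<in>C. (1 + ?g (w i) (w j)) / 2)"
    by (intro sum.cong) auto
  also have "\<dots> = (real (card C) + (\<Sum>w\<in>C. ?g (w i) (w j))) / 2"
    by (simp add: sum.distrib flip: sum_divide_distrib)
  also have "\<dots> = real (card C) / 2 + real (card C) * (real t - real f * (real f - 1)) / ?N / 2
      + (p3 - p4) * (real j - real i - 1)"
    unfolding sgn add_divide_distrib by simp
  \<comment> \<open>The numerator is \<open>(n - f - t) - f * (n - f)\<close>, expanded.\<close>
  also have "p3 - p4 = real (card C) * ((real n - real n * real f - real f + (real f)\<^sup>2 - real t) / ?M)"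
    unfolding p3_def p4_def diff_divide_distrib[symmetric] times_divide_eq_right
    by (rule arg_cong2[where f = "(/)"]) (simp_all add: power2_eq_square algebra_simps)
  finally have total: "(\<Sum>w\<in>C. inv_ind i j w)
      = real (card C) / 2 + real (card C) * (real t - real f * (real f - 1)) / ?N / 2
        + real (card C) * ((real n - real n * real f - real f + (real f)\<^sup>2 - real t) / ?M)
          * (real j - real i - 1)" .
  have factor: "c / 2 + c * (x - y) / N / 2 + c * q * d = c * (1 / 2 + x / (N * 2) - y / (N * 2) + q * d)"
    for c x y N q d :: real
    by (simp add: algebra_simps diff_divide_distrib)
  have "2 * real n * (real n - 1) = ?N * 2" by simp
  then show ?thesis unfolding total by (simp only: factor)
qed

section \<open>Application to the conjugacy class\<close>

text \<open>Makes the expectation under \<open>pmf_of_set\<close> a genuine average and permits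
  division by the size of the class.\<close>

lemma conj_class_ne:
  assumes "lam \<turnstile> n"
  shows "conj_class n lam \<noteq> {}"
proof -
  from assms have "\<forall>r \<in># lam. 0 < r" and n: "sum_mset lam = n"
    by (simp_all add: int_partition_def)
  then obtain w where "w permutes {1..n}" "cycle_type n w = lam"
    using ex_permutation_of_cycle_type by blast
  then have "w \<in> conj_class n lam" by (simp add: conj_class_def sym_group_def)
  then show ?thesis by blast
qed

lemma conj_invariant_counts_conj_class:
  "conj_invariant_counts {1..n} (conj_class n lam) (count lam 1) (2 * count lam 2)"
proof unfold_locales
  fix w assume "w \<in> conj_class n lam"
  then have w: "w permutes {1..n}" and type: "cycle_type n w = lam"
    by (simp_all add: conj_class_def sym_group_def)
  show "w permutes {1..n}" by (rule w)
  have p: "permutation w" using w by (rule permutation_of_permutes) simp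
  show "card {x \<in> {1..n}. w x = x} = count lam 1"
    using card_points_in_orbits_of_size[OF w, of 1] unfolding card_orbit_eq_1_iff[OF p] type by simp
  show "card {x \<in> {1..n}. w x \<noteq> x \<and> w (w x) = x} = 2 * count lam 2"
    using card_points_in_orbits_of_size[OF w, of 2] unfolding card_orbit_eq_2_iff[OF p] type by simp
  fix s :: "nat \<Rightarrow> nat" assume s: "s permutes {1..n}"
  show "s \<circ> w \<circ> inv s \<in> conj_class n lam"
    using cycle_type_conj[OF w s] type permutes_compose[OF permutes_inv[OF s] permutes_compose[OF w s]]
    by (simp add: conj_class_def sym_group_def o_assoc)
qed simp

theorem theorem4p8:
  fixes n :: nat and lam :: "nat multiset" and a :: "nat \<Rightarrow> nat"
    and wt :: "nat \<Rightarrow> nat \<Rightarrow> real" and X :: "(nat \<Rightarrow> nat) \<Rightarrow> real"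
  assumes "n \<ge> 3"
    and "lam \<turnstile> n"
    and "\<forall>r \<in> {1..n}. a r = count lam r"
    and "\<forall>w \<in> sym_group n. X w = weighted_inv_stat n wt w"
  shows "class_expectation n lam X =
     (1 / 2 + real (a 2) / (real n * (real n - 1))
        - real (a 1) * (real (a 1) - 1) / (2 * real n * (real n - 1))) * alpha n wt
     + ((real n - real n * real (a 1) - real (a 1) + (real (a 1))^2 - 2 * real (a 2))
          / (real n * (real n - 1) * (real n - 2))) * beta n wt"
proof -
  let ?C = "conj_class n lam"
  interpret conj_invariant_counts "{1..n}" ?C "count lam 1" "2 * count lam 2"
    by (rule conj_invariant_counts_conj_class)
  \<comment> \<open>\<open>a\<close> agrees with the multiplicities only on \<open>{1..n}\<close>,
    which contains 1 and 2 since \<open>n \<ge> 3\<close>.\<close>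
  have a: "count lam 1 = a 1" "count lam 2 = a 2" using assms(1,3) by auto
  let ?p = "1 / 2 + real (a 2) / (real n * (real n - 1))
      - real (a 1) * (real (a 1) - 1) / (2 * real n * (real n - 1))"
  let ?q = "(real n - real n * real (a 1) - real (a 1) + (real (a 1))^2 - 2 * real (a 2))
      / (real n * (real n - 1) * (real n - 2))"
  have ne: "?C \<noteq> {}" using assms(2) by (rule conj_class_ne)
  then have card: "real (card ?C) \<noteq> 0" using finite_C by simp
  \<comment> \<open>With \<open>t = 2 * a 2\<close> the factor 2 in the denominator of the
    \<open>t\<close> term cancels.\<close>
  have pair: "(\<Sum>w\<in>?C. inv_ind i j w) = real (card ?C) * (?p + ?q * (real j - real i - 1))"
    if "(i, j) \<in> index_pairs n" for i j
    using sum_inv_ind[OF conj_invariant_counts_conj_class assms(1), of i j lam] that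
    unfolding a by (simp add: index_pairs_def)
  have factor: "v * (c * (p + q * d)) = c * (p * v + q * (d * v))" for v c p q d :: real
    by (simp add: algebra_simps)
  have "class_expectation n lam X = (\<Sum>w\<in>?C. X w) / real (card ?C)"
    unfolding class_expectation_def by (rule integral_pmf_of_set[OF ne finite_C])
  also have "(\<Sum>w\<in>?C. X w) = (\<Sum>w\<in>?C. \<Sum>(i, j)\<in>index_pairs n. wt i j * inv_ind i j w)"
    using assms(4) by (intro sum.cong) (auto simp: conj_class_def weighted_inv_stat_def)
  also have "\<dots> = (\<Sum>(i, j)\<in>index_pairs n. \<Sum>w\<in>?C. wt i j * inv_ind i j w)"
    by (subst sum.swap) (simp add: split_beta)
  also have "\<dots> = (\<Sum>(i, j)\<in>index_pairs n.
      real (card ?C) * (?p * wt i j + ?q * ((real j - real i - 1) * wt i j)))"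
  proof (intro sum.cong refl, clarify)
    fix i j assume "(i, j) \<in> index_pairs n"
    then show "(\<Sum>w\<in>?C. wt i j * inv_ind i j w)
        = real (card ?C) * (?p * wt i j + ?q * ((real j - real i - 1) * wt i j))"
      unfolding sum_distrib_left[symmetric] by (simp only: pair factor)
  qed
  also have "\<dots> = real (card ?C) * (?p * alpha n wt + ?q * beta n wt)"
    unfolding alpha_def beta_def sum_distrib_left sum.distrib[symmetric] distrib_left
    by (simp add: split_beta)
  finally show ?thesis using card by simp
qed

end
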